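(* Let $n\ge1$, let $k_0,k_1,\dots,k_n$ be non-negative integers and let $0\leq \tau_0\leq k_0$ be an integer. Then \[ P_q(k_0,k_1,\dots, k_n)=\sum_{\tau_1,\dots,\tau_n} P_q(\tau_0,\tau_1,\dots,\tau_n)\,P_q(k_0-\tau_0,k_1-\tau_1,\dots,k_n-\tau_n)\, q^{\sum_{i=0}^{n-1}\tau_i(k_{i+1}-\tau_{i+1})}, \] where the sum is over integers $\tau_1,\dots,\tau_n$ with $0\le\tau_i\le k_i$.
   Context: $P_q(k_0,\dots,k_n)=\prod_{m=1}^{n}\left[{k_{m-1}+k_m-1 \atop k_m}\right]_q$. Here, for integers $a$ and $b$, $\left[{a\atop b}\right]_q=\prod_{i=1}^{b}\frac{1-q^{a-i+1}}{1-q^i}$ if $b\ge0$ and $0$ if $b<0$; in particular $\left[{-1\atop 0}\right]_q=1$ and $\left[{b-1\atop b}\right]_q=0$ for $b\ge1$. *)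

theory Defs
  imports Complex_Main "HOL-Library.FuncSet"
begin

text \<open>
  The base \<open>q\<close> is an element of an arbitrary field. The defining quotient is meaningful when
  \<open>q ^ i \<noteq> 1\<close> for all \<open>i \<ge> 1\<close>; this covers in particular an indeterminate \<open>q\<close>, taken in the
  field of fractions of a polynomial ring over a field.
  The top argument may be any integer, hence the integer power \<open>powi\<close>. For \<open>q = 0\<close> a negative
  exponent would give a library default value, but no negative exponent occurs in \<open>qP\<close>:
  there \<open>a - i + 1 \<ge> k (m - 1) \<ge> 0\<close> for every factor.
\<close>

definition qbinom :: "'a::field \<Rightarrow> int \<Rightarrow> int \<Rightarrow> 'a" where
  "qbinom q a b =
    (if b \<ge> 0 then (\<Prod>i = 1..nat b. (1 - q powi (a - int i + 1)) / (1 - q ^ i)) else 0)"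

text \<open>Only the values \<open>k 0, \<dots>, k n\<close> matter.\<close>

definition qP :: "'a::field \<Rightarrow> nat \<Rightarrow> (nat \<Rightarrow> nat) \<Rightarrow> 'a" where
  "qP q n k = (\<Prod>m = 1..n. qbinom q (int (k (m - 1)) + int (k m) - 1) (int (k m)))"

lemma qbinom_minus_one_zero: "qbinom q (-1) 0 = 1"
  by (simp add: qbinom_def)

lemma qbinom_pred_self:
  assumes "b \<ge> 1"
  shows "qbinom q (b - 1) b = 0"
proof -
  have "q powi (b - 1 - int (nat b) + 1) = 1" using assms by simp
  then have "\<exists>i\<in>{1..nat b}. (1 - q powi (b - 1 - int i + 1)) / (1 - q ^ i) = 0"
    using assms by (intro bexI[of _ "nat b"]) auto
  then have "(\<Prod>i = 1..nat b. (1 - q powi (b - 1 - int i + 1)) / (1 - q ^ i)) = 0"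
    by (intro prod_zero) auto
  then show ?thesis
    using assms by (simp add: qbinom_def)
qed

end

theory Submission
  imports Defs
begin

text \<open>
  The factor of \<open>P\<^sub>q\<close> with parameters \<open>a, b\<close> is the complete homogeneous symmetric polynomial
  \<open>h\<^sub>b(1, q, \<dots>, q\<^bsup>a-1\<^esup>)\<close>. Splitting its variables into the first \<open>c\<close> and the last
  \<open>a - c\<close> gives a form of the \<open>q\<close>-Vandermonde identity, which is the case \<open>n = 1\<close>; multiplying
  the case \<open>n\<close> by this expansion of the last factor, split at \<open>c = \<tau>\<^sub>n\<close>, gives the case
  \<open>n + 1\<close>.
\<close>

definition qcomplete :: "'a::field \<Rightarrow> nat \<Rightarrow> nat \<Rightarrow> 'a" where
  "qcomplete q a b = (\<Prod>i<b. (1 - q ^ (a + i)) / (1 - q ^ Suc i))"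

lemma qbinom_eq_qcomplete: "qbinom q (int a + int b - 1) (int b) = qcomplete q a b"
proof -
  have "qbinom q (int a + int b - 1) (int b)
      = (\<Prod>i = 1..b. (1 - q ^ (a + b - i)) / (1 - q ^ i))"
  proof -
    have "q powi (int a + int b - 1 - int i + 1) = q ^ (a + b - i)" if "i \<in> {1..b}" for i
    proof -
      have "int a + int b - 1 - int i + 1 = int (a + b - i)"
        using that by simp
      then show ?thesis
        by (simp only: power_int_of_nat)
    qed
    then show ?thesis
      unfolding qbinom_def by (auto intro!: prod.cong)
  qed
  \<comment> \<open>The quotient is split because the numerator is reversed by \<open>i\<close> to
    \<open>b - i\<close>, while the denominator is only shifted by one.\<close>
  also have "\<dots> = (\<Prod>i = 1..b. 1 - q ^ (a + b - i)) / (\<Prod>i = 1..b. 1 - q ^ i)"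
    by (rule prod_dividef)
  also have "(\<Prod>i = 1..b. 1 - q ^ (a + b - i)) = (\<Prod>i<b. 1 - q ^ (a + i))"
    by (rule prod.reindex_bij_witness[of _ "\<lambda>i. b - i" "\<lambda>i. b - i"]) auto
  also have "(\<Prod>i = 1..b. 1 - q ^ i) = (\<Prod>i<b. 1 - q ^ Suc i)"
    by (rule prod.reindex_bij_witness[of _ Suc "\<lambda>i. i - 1"]) auto
  finally show ?thesis
    by (simp add: qcomplete_def prod_dividef)
qed

lemma qcomplete_0_right [simp]: "qcomplete q a 0 = 1"
  by (simp add: qcomplete_def)

lemma qcomplete_0_Suc [simp]: "qcomplete q 0 (Suc b) = 0"
  unfolding qcomplete_def prod.lessThan_Suc_shift by simp

text \<open>The numerators for \<open>a\<close> and \<open>Suc a\<close> are runs of consecutive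
  factors shifted by one, so they differ only at the two ends. Cross-multiplying avoids dividing by
  \<open>1 - q ^ a\<close>, which vanishes at \<open>a = 0\<close>.\<close>

lemma qcomplete_Suc_left:
  "(1 - q ^ a) * qcomplete q (Suc a) b = (1 - q ^ (a + b)) * qcomplete q a b"
  by (induction b) (simp_all add: qcomplete_def mult.commute mult.left_commute)

text \<open>A \<open>q\<close>-Pascal rule: a monomial either avoids the last variable
  \<open>q ^ a\<close> or contains it as a factor.\<close>

lemma qcomplete_rec:
  fixes q :: "'a::field"
  assumes "q ^ Suc b \<noteq> 1"
  shows "qcomplete q (Suc a) (Suc b) = qcomplete q a (Suc b) + q ^ a * qcomplete q (Suc a) b"
proof -
  have nz: "1 - q ^ Suc b \<noteq> 0"
    using assms by simp
  have Suc_right: "(1 - q ^ Suc b) * qcomplete q c (Suc b) = (1 - q ^ (c + b)) * qcomplete q c b" for c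
    using nz by (simp add: qcomplete_def)
  \<comment> \<open>This uses 1 - q^(a+b+1) = (1 - q^a) + q^a (1 - q^(b+1)).\<close>
  have "(1 - q ^ Suc b) * qcomplete q (Suc a) (Suc b)
      = (1 - q ^ a) * qcomplete q (Suc a) b + (1 - q ^ Suc b) * (q ^ a * qcomplete q (Suc a) b)"
    unfolding Suc_right by (simp add: algebra_simps power_add)
  also have "\<dots> = (1 - q ^ Suc b) * (qcomplete q a (Suc b) + q ^ a * qcomplete q (Suc a) b)"
    by (simp only: qcomplete_Suc_left distrib_left Suc_right)
  finally show ?thesis
    using nz by (simp only: mult_cancel_left) simp
qed

text \<open>The last \<open>c\<close> variables are \<open>q ^ a\<close> times the first
  \<open>c\<close> powers of \<open>q\<close>, so homogeneity of degree \<open>b - t\<close>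
  produces the weight. The induction is double because the Pascal rule lowers either
  \<open>c\<close> or \<open>b\<close>.\<close>

lemma qcomplete_add:
  fixes q :: "'a::field"
  assumes q: "\<And>i. i \<ge> 1 \<Longrightarrow> q ^ i \<noteq> 1"
  shows "qcomplete q (a + c) b
    = (\<Sum>t\<le>b. qcomplete q a t * qcomplete q c (b - t) * q ^ (a * (b - t)))"
proof (induction c arbitrary: b)
  case 0
  have "qcomplete q 0 (b - t) = 0" if "t < b" for t
    using that by (cases "b - t") auto
  then have "(\<Sum>t<b. qcomplete q a t * qcomplete q 0 (b - t) * q ^ (a * (b - t))) = 0"
    by (intro sum.neutral) auto
  then show ?case
    by (simp add: lessThan_Suc_atMost[symmetric])
next
  case (Suc c)
  note IH_c = Suc.IH
  show ?case
  proof (induction b)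
    case 0
    show ?case by simp
  next
    case (Suc b)
    let ?f = "\<lambda>c b t. qcomplete q a t * qcomplete q c (b - t) * q ^ (a * (b - t))"
    have step: "?f (Suc c) (Suc b) t = ?f c (Suc b) t + q ^ (a + c) * ?f (Suc c) b t"
      if "t \<le> b" for t
    proof -
      have "qcomplete q (Suc c) (Suc (b - t))
          = qcomplete q c (Suc (b - t)) + q ^ c * qcomplete q (Suc c) (b - t)"
        by (intro qcomplete_rec q) simp
      with that show ?thesis
        by (simp add: Suc_diff_le power_add distrib_left distrib_right mult_ac)
    qed
    \<comment> \<open>The term \<open>t = Suc b\<close> lies outside \<open>step\<close>; there the
      second factor has degree 0, so the terms for \<open>Suc c\<close> and \<open>c\<close>
      agree.\<close>
    have "(\<Sum>t\<le>Suc b. ?f (Suc c) (Suc b) t)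
        = (\<Sum>t\<le>Suc b. ?f c (Suc b) t) + q ^ (a + c) * (\<Sum>t\<le>b. ?f (Suc c) b t)"
      by (simp add: step sum.distrib sum_distrib_left)
    also have "\<dots> = qcomplete q (a + c) (Suc b) + q ^ (a + c) * qcomplete q (a + Suc c) b"
      by (simp only: Suc.IH IH_c)
    also have "\<dots> = qcomplete q (a + Suc c) (Suc b)"
      using qcomplete_rec[OF q, of b "a + c"] by simp
    finally show ?case by simp
  qed
qed

lemma qP_0 [simp]: "qP q 0 k = 1"
  by (simp add: qP_def)

lemma qP_Suc: "qP q (Suc n) k = qP q n k * qcomplete q (k n) (k (Suc n))"
  by (simp add: qP_def qbinom_eq_qcomplete)

lemma qP_cong:
  assumes "\<And>i. i \<le> n \<Longrightarrow> k i = l i"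
  shows "qP q n k = qP q n l"
  unfolding qP_def using assms by (intro prod.cong) auto

lemma sum_extensional_Suc:
  fixes F :: "(nat \<Rightarrow> nat) \<Rightarrow> 'b::comm_monoid_add" and k :: "nat \<Rightarrow> nat" and t0 :: nat
  defines "T \<equiv> \<lambda>n. {\<tau> \<in> extensional {0..n}. \<tau> 0 = t0 \<and> (\<forall>i\<in>{1..n}. \<tau> i \<le> k i)}"
  shows "(\<Sum>\<tau>\<in>T (Suc n). F \<tau>) = (\<Sum>\<tau>\<in>T n. \<Sum>t\<le>k (Suc n). F (\<tau>(Suc n := t)))"
proof -
  have "(\<Sum>\<tau>\<in>T (Suc n). F \<tau>) = (\<Sum>(\<tau>, t)\<in>T n \<times> {..k (Suc n)}. F (\<tau>(Suc n := t)))"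
    \<comment> \<open>Extensionality makes these maps mutually inverse: restriction resets the entry
      at \<open>Suc n\<close> to \<open>undefined\<close>, the value it has for every member of
      \<open>T n\<close>.\<close>
    by (rule sum.reindex_bij_witness[of _ "\<lambda>(\<tau>, t). \<tau>(Suc n := t)"
          "\<lambda>\<tau>. (restrict \<tau> {0..n}, \<tau> (Suc n))"])
      (auto simp: T_def extensional_def fun_eq_iff le_Suc_eq intro!: arg_cong[where f = F])
  then show ?thesis
    by (simp add: sum.cartesian_product)
qed

lemma qP_split:
  fixes q :: "'a::field"
  assumes q: "\<And>i. i \<ge> 1 \<Longrightarrow> q ^ i \<noteq> 1" and t0: "t0 \<le> k 0"
  shows "qP q n k =
    (\<Sum>\<tau> \<in> {\<tau> \<in> extensional {0..n}. \<tau> 0 = t0 \<and> (\<forall>i\<in>{1..n}. \<tau> i \<le> k i)}.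
       qP q n \<tau> * qP q n (\<lambda>i. k i - \<tau> i) *
       q ^ (\<Sum>i = 0..<n. \<tau> i * (k (i + 1) - \<tau> (i + 1))))"
proof (induction n)
  case 0
  \<comment> \<open>For \<open>n = 0\<close> a single tuple remains and all products are
    empty.\<close>
  have "{\<tau> \<in> extensional {0..0::nat}. \<tau> 0 = t0 \<and> (\<forall>i\<in>{1..0}. \<tau> i \<le> k i)}
      = {restrict (\<lambda>_. t0) {0}}"
    by (auto simp: extensional_def fun_eq_iff)
  then show ?case by simp
next
  case (Suc n)
  define T where "T = {\<tau> \<in> extensional {0..n}. \<tau> 0 = t0 \<and> (\<forall>i\<in>{1..n}. \<tau> i \<le> k i)}"
  define E where "E n \<tau> = (\<Sum>i = 0..<n. \<tau> i * (k (i + 1) - \<tau> (i + 1)))" for n and \<tau> :: "nat \<Rightarrow> nat"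
  define G where "G n \<tau> = qP q n \<tau> * qP q n (\<lambda>i. k i - \<tau> i) * q ^ E n \<tau>" for n \<tau>
  have step: "G n \<tau> * qcomplete q (k n) (k (Suc n)) = (\<Sum>t\<le>k (Suc n). G (Suc n) (\<tau>(Suc n := t)))"
    if "\<tau> \<in> T" for \<tau>
  proof -
    let ?h = "\<lambda>t. qcomplete q (\<tau> n) t * qcomplete q (k n - \<tau> n) (k (Suc n) - t)
        * q ^ (\<tau> n * (k (Suc n) - t))"
    \<comment> \<open>This makes the truncated difference \<open>k n - \<tau> n\<close> a true one,
      so the two parts add up to \<open>k n\<close>. For \<open>n = 0\<close> the bound comes from
      \<open>t0\<close>.\<close>
    have "\<tau> n \<le> k n"
      using that t0 by (cases n) (auto simp: T_def)
    then have "qcomplete q (k n) (k (Suc n)) = (\<Sum>t\<le>k (Suc n). ?h t)"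
      using qcomplete_add[OF q, where a = "\<tau> n" and c = "k n - \<tau> n"] by simp
    moreover have "G (Suc n) (\<tau>(Suc n := t)) = G n \<tau> * ?h t" for t
    proof -
      have "qP q n (\<tau>(Suc n := t)) = qP q n \<tau>"
        "qP q n (\<lambda>i. k i - (\<tau>(Suc n := t)) i) = qP q n (\<lambda>i. k i - \<tau> i)"
        by (rule qP_cong; simp)+
      moreover have "E (Suc n) (\<tau>(Suc n := t)) = E n \<tau> + \<tau> n * (k (Suc n) - t)"
        unfolding E_def by (simp add: sum.atLeast0_lessThan_Suc)
      ultimately show ?thesis
        by (simp add: G_def qP_Suc power_add mult_ac)
    qed
    ultimately show ?thesis
      by (simp add: sum_distrib_left)
  qed
  have "qP q (Suc n) k = (\<Sum>\<tau>\<in>T. G n \<tau> * qcomplete q (k n) (k (Suc n)))"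
    unfolding qP_Suc Suc.IH by (simp add: T_def G_def E_def sum_distrib_right)
  also have "\<dots> = (\<Sum>\<tau>\<in>T. \<Sum>t\<le>k (Suc n). G (Suc n) (\<tau>(Suc n := t)))"
    by (intro sum.cong refl step)
  finally show ?case
    by (simp only: T_def sum_extensional_Suc[symmetric]) (simp only: G_def E_def)
qed

theorem theorem4p2:
  fixes q :: "'a::field" and n :: nat and k :: "nat \<Rightarrow> nat" and \<tau>\<^sub>0 :: nat
  assumes "\<And>i::nat. i \<ge> 1 \<Longrightarrow> q ^ i \<noteq> 1"
    and "n \<ge> 1"
    and "\<tau>\<^sub>0 \<le> k 0"
  shows "qP q n k =
    (\<Sum>\<tau> \<in> {\<tau> \<in> extensional {0..n}. \<tau> 0 = \<tau>\<^sub>0 \<and> (\<forall>i\<in>{1..n}. \<tau> i \<le> k i)}.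
       qP q n \<tau> * qP q n (\<lambda>i. k i - \<tau> i) *
       q ^ (\<Sum>i = 0..<n. \<tau> i * (k (i + 1) - \<tau> (i + 1))))"
  using assms(1,3) by (rule qP_split)

end
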